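(* $\mathrm{L}^{\circlearrowleft}$-grammars recognize all permutations of regular languages: for every finite alphabet $\Sigma$ and every regular language $L\subseteq\Sigma^+$ (i.e. not containing the empty word), there exists an $\mathrm{L}^{\circlearrowleft}$-grammar $G$ over $\Sigma$ such that $L(G)=\mathrm{PERM}(L)$, where $\mathrm{PERM}(L)=\{a_{\sigma(1)}\dots a_{\sigma(n)}\mid a_1\dots a_n\in L,\ \sigma\in S_n\}$.
   Context: Types are built from primitive types (elements of a fixed countably infinite set $Pr$) using the binary connectives $\backslash$, $/$, $\cdot$ and a unary connective $A\mapsto A^{\circlearrowleft}$; the set of all types is $Tp^{\circlearrowleft}$. A sequent is $A_1,\dots,A_n\to B$ with $n\ge 1$ and $A_i,B$ types. Capital Latin letters denote types, $\Gamma,\Delta$ finite (possibly empty) sequences of types, $\Pi,\Psi$ nonempty finite sequences of types. Axioms and rules of $\mathrm{L}^{\circlearrowleft}$: - $(\mathrm{Ax})$: $A\to A$. - $(\backslash\to)$: from $\Gamma,B,\Delta\to C$ and $\Pi\to A$ infer $\Gamma,\Pi,A\backslash B,\Delta\to C$. - $(\to\backslash)$: from $A,\Pi\to B$ infer $\Pi\to A\backslash B$. - $(/\to)$: from $\Gamma,B,\Delta\to C$ and $\Pi\to A$ infer $\Gamma,B/A,\Pi,\Delta\to C$. - $(\to/)$: from $\Pi,A\to B$ infer $\Pi\to B/A$. - $(\cdot\to)$: from $\Gamma,A,B,\Delta\to C$ infer $\Gamma,A\cdot B,\Delta\to C$. - $(\to\cdot)$: from $\Pi\to A$ and $\Psi\to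 B$ infer $\Pi,\Psi\to A\cdot B$. - $(\mathrm{cut})$: from $\Pi\to A$ and $\Gamma,A,\Delta\to B$ infer $\Gamma,\Pi,\Delta\to B$. - $(\to^{\circlearrowleft})$: from $\Pi\to A$ infer $\Pi\to A^{\circlearrowleft}$. - $(^{\circlearrowleft}\to)$: from $B\to A^{\circlearrowleft}$ infer $B^{\circlearrowleft}\to A^{\circlearrowleft}$. - $(\circlearrowleft)$: from $\Pi,\Psi\to A^{\circlearrowleft}$ infer $\Psi,\Pi\to A^{\circlearrowleft}$. An $\mathrm{L}^{\circlearrowleft}$-grammar is a triple $G=\langle\Sigma,T,\triangleright\rangle$ where $\Sigma$ is a finite alphabet, $T\in Tp^{\circlearrowleft}$ is a distinguished type, and $\triangleright\subseteq\Sigma\times Tp^{\circlearrowleft}$ is a finite binary relation. The language recognized by $G$ is $L(G)=\{a_1\dots a_n\in\Sigma^+\mid \exists\,T_1,\dots,T_n\in Tp^{\circlearrowleft}:\ a_i\triangleright T_i\text{ for } i=1,\dots,n,\text{ and } \mathrm{L}^{\circlearrowleft}\vdash T_1,\dots,T_n\to T\}$. *)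

theory Defs
  imports Main "HOL-Combinatorics.Permutations"
begin

(* nat serves as the countably infinite set of primitive types.
   Under A B is the type A\B (argument first), and Over B A is B/A (result first). *)
datatype tp =
    Prim nat
  | Under tp tp
  | Over tp tp
  | Prod tp tp
  | Circ tp

(* FuncSet reserves the letter Pi as a binder, so Phi stands for a nonempty antecedent. *)
inductive derivable :: "tp list \<Rightarrow> tp \<Rightarrow> bool" (infix "\<turnstile>" 50) where
  ax: "[A] \<turnstile> A"
| under_left: "\<lbrakk>\<Gamma> @ [B] @ \<Delta> \<turnstile> C; \<Phi> \<turnstile> A; \<Phi> \<noteq> []\<rbrakk> \<Longrightarrow> \<Gamma> @ \<Phi> @ [Under A B] @ \<Delta> \<turnstile> C"
| under_right: "\<lbrakk>[A] @ \<Phi> \<turnstile> B; \<Phi> \<noteq> []\<rbrakk> \<Longrightarrow> \<Phi> \<turnstile> Under A B"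
| over_left: "\<lbrakk>\<Gamma> @ [B] @ \<Delta> \<turnstile> C; \<Phi> \<turnstile> A; \<Phi> \<noteq> []\<rbrakk> \<Longrightarrow> \<Gamma> @ [Over B A] @ \<Phi> @ \<Delta> \<turnstile> C"
| over_right: "\<lbrakk>\<Phi> @ [A] \<turnstile> B; \<Phi> \<noteq> []\<rbrakk> \<Longrightarrow> \<Phi> \<turnstile> Over B A"
| prod_left: "\<Gamma> @ [A, B] @ \<Delta> \<turnstile> C \<Longrightarrow> \<Gamma> @ [Prod A B] @ \<Delta> \<turnstile> C"
| prod_right: "\<lbrakk>\<Phi> \<turnstile> A; \<Psi> \<turnstile> B; \<Phi> \<noteq> []; \<Psi> \<noteq> []\<rbrakk> \<Longrightarrow> \<Phi> @ \<Psi> \<turnstile> Prod A B"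
| cut: "\<lbrakk>\<Phi> \<turnstile> A; \<Gamma> @ [A] @ \<Delta> \<turnstile> B; \<Phi> \<noteq> []\<rbrakk> \<Longrightarrow> \<Gamma> @ \<Phi> @ \<Delta> \<turnstile> B"
| circ_right: "\<lbrakk>\<Phi> \<turnstile> A; \<Phi> \<noteq> []\<rbrakk> \<Longrightarrow> \<Phi> \<turnstile> Circ A"
| circ_left: "[B] \<turnstile> Circ A \<Longrightarrow> [Circ B] \<turnstile> Circ A"
| circ_shift: "\<lbrakk>\<Phi> @ \<Psi> \<turnstile> Circ A; \<Phi> \<noteq> []; \<Psi> \<noteq> []\<rbrakk> \<Longrightarrow> \<Psi> @ \<Phi> \<turnstile> Circ A"

definition nonempty_words :: "'a set \<Rightarrow> 'a list set" where
  "nonempty_words \<Sigma> = lists \<Sigma> - {[]}"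

record 'a grammar =
  alphabet :: "'a set"
  dist_type :: tp
  lexicon :: "('a \<times> tp) set"

definition is_grammar :: "'a grammar \<Rightarrow> bool" where
  "is_grammar G \<longleftrightarrow>
     finite (alphabet G) \<and> finite (lexicon G) \<and> lexicon G \<subseteq> alphabet G \<times> UNIV"

definition grammar_lang :: "'a grammar \<Rightarrow> 'a list set" where
  "grammar_lang G = {w \<in> nonempty_words (alphabet G).
     \<exists>Ts. list_all2 (\<lambda>a A. (a, A) \<in> lexicon G) w Ts \<and> Ts \<turnstile> dist_type G}"

record ('q, 'a) dfa =
  states :: "'q set"
  init :: 'q
  trans :: "'q \<Rightarrow> 'a \<Rightarrow> 'q"
  final :: "'q set"

definition is_dfa :: "'a set \<Rightarrow> ('q, 'a) dfa \<Rightarrow> bool" where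
  "is_dfa \<Sigma> M \<longleftrightarrow>
     finite (states M) \<and> init M \<in> states M \<and> final M \<subseteq> states M \<and>
     (\<forall>q \<in> states M. \<forall>a \<in> \<Sigma>. trans M q a \<in> states M)"

definition dfa_lang :: "'a set \<Rightarrow> ('q, 'a) dfa \<Rightarrow> 'a list set" where
  "dfa_lang \<Sigma> M = {w \<in> lists \<Sigma>. foldl (trans M) (init M) w \<in> final M}"

(* No generality is lost by taking states from nat, since state sets are finite. *)
definition regular :: "'a set \<Rightarrow> 'a list set \<Rightarrow> bool" where
  "regular \<Sigma> L \<longleftrightarrow> (\<exists>M :: (nat, 'a) dfa. is_dfa \<Sigma> M \<and> L = dfa_lang \<Sigma> M)"

definition PERM :: "'a list set \<Rightarrow> 'a list set" where
  "PERM L = {permute_list \<sigma> w | \<sigma> w. w \<in> L \<and> \<sigma> permutes {..<length w}}"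

end

(* Write K for Circ S. Since Circ types on the right allow rotation, the double negation
   Under (Circ (Under X K)) K of a type X behaves in an antecedent of K like a copy of X
   that may be moved anywhere in the (cyclic) antecedent. Assigning to each letter the
   double negations of the Lambek types describing the transitions of an automaton therefore
   makes every permutation of an accepted word derivable.
   Conversely, the calculus is sound for subsets of any commutative monoid with Circ read as
   the identity; interpreting the primitive types as Parikh images shows that nothing else
   is recognized. *)
theory Submission
  imports Defs "HOL-Library.Set_Algebras"
begin

section \<open>Soundness in subsets of commutative monoids\<close>

fun interp :: "(nat \<Rightarrow> 'b::comm_monoid_add set) \<Rightarrow> tp \<Rightarrow> 'b set" where
  "interp v (Prim n) = v n"
| "interp v (Under A B) = {m. interp v A + {m} \<subseteq> interp v B}"
| "interp v (Over B A) = {m. interp v A + {m} \<subseteq> interp v B}"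
| "interp v (Prod A B) = interp v A + interp v B"
| "interp v (Circ A) = interp v A"

lemma subset_residual_iff:
  fixes X Y Z :: "'b::comm_monoid_add set"
  shows "Y \<subseteq> {m. X + {m} \<subseteq> Z} \<longleftrightarrow> X + Y \<subseteq> Z"
  by (fastforce simp: set_plus_def)

lemma residual_plus_subset:
  fixes X Y Z :: "'b::comm_monoid_add set"
  assumes "X \<subseteq> Y"
  shows "X + {m. Y + {m} \<subseteq> Z} \<subseteq> Z"
  using assms by (fastforce simp: set_plus_def)

text \<open>Commutativity turns both divisions into the same residual and validates
  \<open>circ_shift\<close>, so \<open>Circ\<close> adds nothing semantically. The right division
  rules follow from \<open>subset_residual_iff\<close>, the left ones from
  \<open>residual_plus_subset\<close>.\<close>

lemma derivable_sound: "\<Gamma> \<turnstile> A \<Longrightarrow> sum_list (map (interp v) \<Gamma>) \<subseteq> interp v A"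
proof (induction rule: derivable.induct)
  case (under_left \<Gamma> B \<Delta> C \<Phi> A)
  let ?s = "\<lambda>\<Gamma>. sum_list (map (interp v) \<Gamma>)"
  have "?s \<Phi> + interp v (Under A B) \<subseteq> interp v B"
    using residual_plus_subset[OF under_left.IH(2)] by simp
  then have "?s \<Gamma> + (?s \<Phi> + interp v (Under A B)) + ?s \<Delta> \<subseteq> ?s \<Gamma> + interp v B + ?s \<Delta>"
    by (intro set_plus_mono2 order_refl)
  also have "\<dots> \<subseteq> interp v C" using under_left.IH(1) by (simp add: add.assoc)
  finally show ?case by (simp add: add.assoc)
next
  case (over_left \<Gamma> B \<Delta> C \<Phi> A)
  let ?s = "\<lambda>\<Gamma>. sum_list (map (interp v) \<Gamma>)"
  have "?s \<Phi> + interp v (Over B A) \<subseteq> interp v B"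
    using residual_plus_subset[OF over_left.IH(2)] by simp
  then have "?s \<Gamma> + (?s \<Phi> + interp v (Over B A)) + ?s \<Delta> \<subseteq> ?s \<Gamma> + interp v B + ?s \<Delta>"
    by (intro set_plus_mono2 order_refl)
  also have "\<dots> \<subseteq> interp v C" using over_left.IH(1) by (simp add: add.assoc)
  finally show ?case by (simp add: ac_simps)
next
  case (cut \<Phi> A \<Gamma> \<Delta> B)
  let ?s = "\<lambda>\<Gamma>. sum_list (map (interp v) \<Gamma>)"
  have "?s \<Gamma> + ?s \<Phi> + ?s \<Delta> \<subseteq> ?s \<Gamma> + interp v A + ?s \<Delta>"
    using cut.IH(1) by (intro set_plus_mono2 order_refl)
  also have "\<dots> \<subseteq> interp v B" using cut.IH(2) by (simp add: add.assoc)
  finally show ?case by (simp add: add.assoc)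
next
  case (under_right A \<Phi> B)
  then show ?case by (simp add: subset_residual_iff)
next
  case (over_right \<Phi> A B)
  then show ?case by (simp add: subset_residual_iff add.commute[of _ "interp v A"])
qed (simp_all add: set_plus_mono2 ac_simps)

lemma sum_list_in_interp:
  assumes "list_all2 (\<lambda>a A. f a \<in> interp v A) w Ts" and "Ts \<turnstile> B"
  shows "sum_list (map f w) \<in> interp v B"
proof -
  from assms(1) have "sum_list (map f w) \<in> sum_list (map (interp v) Ts)"
    by (induction) (auto intro: set_plus_intro)
  then show ?thesis using derivable_sound[OF assms(2)] by blast
qed

section \<open>Movable types\<close>

definition movable :: "tp \<Rightarrow> tp \<Rightarrow> tp" where
  "movable S X = Under (Circ (Under X (Circ S))) (Circ S)"

text \<open>A set embeds into its double residual. Hence making a type movable preserves the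
  soundness of a lexicon entry.\<close>

lemma interp_movable: "interp v X \<subseteq> interp v (movable S X)"
  by (fastforce simp: movable_def set_plus_def add.commute)

lemma derivable_rotate: "\<Phi> @ \<Psi> \<turnstile> Circ A \<Longrightarrow> \<Psi> @ \<Phi> \<turnstile> Circ A"
  by (cases "\<Phi> = [] \<or> \<Psi> = []") (auto intro: circ_shift)

lemma derivable_move:
  assumes "\<Phi> @ [X] @ \<Psi> @ \<Theta> \<turnstile> Circ S" and "\<Phi> @ \<Psi> @ \<Theta> \<noteq> []"
  shows "\<Phi> @ \<Psi> @ [movable S X] @ \<Theta> \<turnstile> Circ S"
proof -
  from assms(1) have "[X] @ (\<Psi> @ \<Theta> @ \<Phi>) \<turnstile> Circ S"
    using derivable_rotate[of \<Phi> "[X] @ \<Psi> @ \<Theta>" S] by simp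
  then have "\<Psi> @ \<Theta> @ \<Phi> \<turnstile> Circ (Under X (Circ S))"
    using assms(2) by (auto intro!: circ_right[of _ "Under X (Circ S)"] under_right)
  then have "\<Theta> @ \<Phi> @ \<Psi> \<turnstile> Circ (Under X (Circ S))"
    using derivable_rotate[of \<Psi> "\<Theta> @ \<Phi>"] by simp
  \<comment> \<open>The argument of the double negation is the whole remaining context, read
    cyclically from just after the target position; the major premise is an axiom.\<close>
  then have "[] @ (\<Theta> @ \<Phi> @ \<Psi>) @ [movable S X] @ [] \<turnstile> Circ S"
    unfolding movable_def using assms(2) by (intro under_left) (auto intro: ax)
  then show ?thesis
    using derivable_rotate[of \<Theta> "\<Phi> @ \<Psi> @ [movable S X]" S] by simp
qed

text \<open>From the last entry of \<open>Ys\<close> backwards, each type is moved to the right end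
  of the plain ones and joins \<open>Zs\<close>. The total length stays constant, so the context
  left by a moved type is never empty.\<close>

lemma derivable_permute_movable:
  assumes "Xs @ Zs \<turnstile> Circ S" and "mset Xs = mset Ys" and "2 \<le> length (Xs @ Zs)"
  shows "map (movable S) Ys @ Zs \<turnstile> Circ S"
  using assms
proof (induction Ys arbitrary: Xs Zs rule: rev_induct)
  case Nil
  then show ?case by simp
next
  case (snoc y Ys)
  have "y \<in> set Xs" using snoc.prems(2) by (metis in_set_conv_decomp set_mset_mset)
  then obtain A B where Xs: "Xs = A @ y # B" by (meson split_list)
  have "A @ B @ [movable S y] @ Zs \<turnstile> Circ S"
    using snoc.prems Xs by (intro derivable_move) auto
  then have "map (movable S) Ys @ (movable S y # Zs) \<turnstile> Circ S"
    using snoc.prems Xs by (intro snoc.IH[of "A @ B"]) auto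
  then show ?case by simp
qed

section \<open>The grammar of an automaton\<close>

text \<open>\<^term>\<open>Prim 0\<close> stands for acceptance, \<^term>\<open>Prim (Suc q)\<close> for the state \<^term>\<open>q\<close>.\<close>

definition target_types :: "(nat, 'a) dfa \<Rightarrow> nat \<Rightarrow> tp set" where
  "target_types M q = insert (Prim (Suc q)) (if q \<in> final M then {Prim 0} else {})"

text \<open>The first set serves the first letter of a word: the empty prefix before it cannot
  derive the type of the initial state, as antecedents are nonempty.\<close>

definition letter_types :: "(nat, 'a) dfa \<Rightarrow> 'a \<Rightarrow> tp set" where
  "letter_types M a = target_types M (trans M (init M) a) \<union>
     (\<Union>q\<in>states M. Under (Prim (Suc q)) ` target_types M (trans M q a))"

text \<open>The plain types are needed for words of length one: a movable type can only be used
  next to another one, since antecedents are nonempty.\<close>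

definition perm_grammar :: "'a set \<Rightarrow> (nat, 'a) dfa \<Rightarrow> 'a grammar" where
  "perm_grammar \<Sigma> M = \<lparr>alphabet = \<Sigma>, dist_type = Circ (Prim 0),
     lexicon = (SIGMA a:\<Sigma>. letter_types M a \<union> movable (Prim 0) ` letter_types M a)\<rparr>"

lemma foldl_trans_in_states:
  assumes "is_dfa \<Sigma> M" and "w \<in> lists \<Sigma>"
  shows "foldl (trans M) (init M) w \<in> states M"
  using assms(2) by (induction w rule: rev_induct) (use assms(1) in \<open>auto simp: is_dfa_def\<close>)

lemma is_grammar_perm_grammar:
  assumes "finite \<Sigma>" and "is_dfa \<Sigma> M"
  shows "is_grammar (perm_grammar \<Sigma> M)"
  using assms
  by (auto simp: is_grammar_def perm_grammar_def letter_types_def target_types_def is_dfa_def)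

text \<open>The last letter's type consumes the state type derived from the prefix. \<open>A\<close>
  varies because the prefix must yield a state, whereas the full word must yield acceptance.\<close>

lemma derivable_letter_types:
  assumes "is_dfa \<Sigma> M" and "w \<in> lists \<Sigma>" and "w \<noteq> []"
    and "A \<in> target_types M (foldl (trans M) (init M) w)"
  shows "\<exists>Xs. list_all2 (\<lambda>a X. X \<in> letter_types M a) w Xs \<and> Xs \<turnstile> A"
  using assms(2-4)
proof (induction w arbitrary: A rule: rev_induct)
  case Nil
  then show ?case by simp
next
  case (snoc a w)
  show ?case
  proof (cases "w = []")
    case True
    then have "list_all2 (\<lambda>a X. X \<in> letter_types M a) (w @ [a]) [A]"
      using snoc.prems by (simp add: letter_types_def)
    then show ?thesis using ax by blast
  next
    case False
    let ?q = "foldl (trans M) (init M) w"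
    have w: "w \<in> lists \<Sigma>" using snoc.prems by simp
    have "Prim (Suc ?q) \<in> target_types M ?q" by (simp add: target_types_def)
    then obtain Xs where Xs: "list_all2 (\<lambda>a X. X \<in> letter_types M a) w Xs" "Xs \<turnstile> Prim (Suc ?q)"
      using snoc.IH w False by blast
    have "Under (Prim (Suc ?q)) A \<in> letter_types M a"
      using snoc.prems(3) foldl_trans_in_states[OF assms(1) w] by (auto simp: letter_types_def)
    then have "list_all2 (\<lambda>a X. X \<in> letter_types M a) (w @ [a]) (Xs @ [Under (Prim (Suc ?q)) A])"
      using Xs(1) by (simp add: list_all2_appendI)
    moreover have "[] @ Xs @ [Under (Prim (Suc ?q)) A] @ [] \<turnstile> A"
      using Xs False by (intro under_left) (auto intro: ax)
    ultimately show ?thesis by auto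
  qed
qed

definition parikh_val :: "'a set \<Rightarrow> (nat, 'a) dfa \<Rightarrow> nat \<Rightarrow> 'a multiset set" where
  "parikh_val \<Sigma> M n = mset ` (case n of 0 \<Rightarrow> dfa_lang \<Sigma> M
     | Suc q \<Rightarrow> {w \<in> lists \<Sigma>. foldl (trans M) (init M) w = q})"

lemma target_types_sound:
  assumes "w \<in> lists \<Sigma>" and "A \<in> target_types M (foldl (trans M) (init M) w)"
  shows "mset w \<in> interp (parikh_val \<Sigma> M) A"
  using assms by (auto simp: target_types_def parikh_val_def dfa_lang_def split: if_splits)

text \<open>Appending \<open>a\<close> to a word that reaches \<open>q\<close> adds \<open>a\<close>
  to its Parikh image and reaches \<open>trans M q a\<close>, as the division demands.\<close>

lemma letter_types_sound:
  assumes "a \<in> \<Sigma>" and "X \<in> letter_types M a"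
  shows "{#a#} \<in> interp (parikh_val \<Sigma> M) X"
  using assms(2) unfolding letter_types_def
proof (elim UnE UN_E imageE)
  assume "X \<in> target_types M (trans M (init M) a)"
  then show ?thesis using assms(1) target_types_sound[of "[a]" \<Sigma> X M] by simp
next
  fix q A assume X: "X = Under (Prim (Suc q)) A" and A: "A \<in> target_types M (trans M q a)"
  have "mset w + {#a#} \<in> interp (parikh_val \<Sigma> M) A"
    if "w \<in> lists \<Sigma>" "foldl (trans M) (init M) w = q" for w
    using that A assms(1) target_types_sound[of "w @ [a]" \<Sigma> A M] by simp
  then show ?thesis by (auto simp: X parikh_val_def set_plus_def)
qed

lemma PERM_eq_mset: "PERM L = {w. mset w \<in> mset ` L}"
proof (intro set_eqI iffI)
  fix w assume "w \<in> {w. mset w \<in> mset ` L}"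
  then obtain v where v: "v \<in> L" "mset w = mset v" by auto
  from mset_eq_permutation[OF v(2)] obtain \<sigma>
    where "\<sigma> permutes {..<length v}" "permute_list \<sigma> v = w" .
  with v(1) show "w \<in> PERM L" unfolding PERM_def by blast
qed (auto simp: PERM_def)

lemma grammar_lang_perm_grammar:
  assumes M: "is_dfa \<Sigma> M" and L: "dfa_lang \<Sigma> M \<subseteq> nonempty_words \<Sigma>"
  shows "grammar_lang (perm_grammar \<Sigma> M) = PERM (dfa_lang \<Sigma> M)"
proof (intro set_eqI iffI)
  let ?G = "perm_grammar \<Sigma> M"
  let ?v = "parikh_val \<Sigma> M"
  fix w assume "w \<in> grammar_lang ?G"
  then obtain Ts where Ts: "list_all2 (\<lambda>a A. (a, A) \<in> lexicon ?G) w Ts" "Ts \<turnstile> Circ (Prim 0)"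
    by (auto simp: grammar_lang_def perm_grammar_def)
  have "{#a#} \<in> interp ?v A" if "(a, A) \<in> lexicon ?G" for a A
    using that letter_types_sound[of a \<Sigma> _ M] interp_movable[of ?v _ "Prim 0"]
    by (fastforce simp: perm_grammar_def)
  then have "list_all2 (\<lambda>a A. {#a#} \<in> interp ?v A) w Ts"
    using Ts(1) by (auto elim: list_all2_mono)
  \<comment> \<open>The singletons add up to \<open>mset w\<close>, and \<open>Circ (Prim 0)\<close>
    denotes the Parikh image of the language.\<close>
  from sum_list_in_interp[OF this Ts(2)] have "mset w \<in> mset ` dfa_lang \<Sigma> M"
    by (simp add: parikh_val_def sum_list_singleton_mset)
  then show "w \<in> PERM (dfa_lang \<Sigma> M)" by (simp add: PERM_eq_mset)
next
  let ?G = "perm_grammar \<Sigma> M"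
  let ?P = "\<lambda>a X. X \<in> letter_types M a"
  fix w assume "w \<in> PERM (dfa_lang \<Sigma> M)"
  then obtain u where u: "u \<in> dfa_lang \<Sigma> M" "mset w = mset u" by (auto simp: PERM_eq_mset)
  have u': "u \<in> lists \<Sigma>" "u \<noteq> []" using u(1) L by (auto simp: nonempty_words_def)
  have w: "w \<in> nonempty_words \<Sigma>"
    using u' u(2) mset_eq_setD[OF u(2)] by (auto simp: nonempty_words_def)
  have "Prim 0 \<in> target_types M (foldl (trans M) (init M) u)"
    using u(1) by (simp add: dfa_lang_def target_types_def)
  then obtain Xs where Xs: "list_all2 ?P u Xs" "Xs \<turnstile> Prim 0"
    using derivable_letter_types[OF M u'] by blast
  have len: "length Xs = length u" using Xs(1) by (simp add: list_all2_lengthD)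
  have circ: "Xs \<turnstile> Circ (Prim 0)" using Xs(2) len u'(2) by (intro circ_right) auto
  have "\<exists>Ts. list_all2 (\<lambda>a A. (a, A) \<in> lexicon ?G) w Ts \<and> Ts \<turnstile> Circ (Prim 0)"
  proof (cases "2 \<le> length u")
    case True
    \<comment> \<open>The types are permuted along with their letters.\<close>
    obtain Ys where Ys: "list_all2 ?P w Ys" "mset Ys = mset Xs"
      using list_all2_reorder_left_invariance[OF Xs(1) u(2)] by blast
    have "map (movable (Prim 0)) Ys \<turnstile> Circ (Prim 0)"
      using derivable_permute_movable[of Xs "[]" "Prim 0" Ys] circ Ys(2) True len by simp
    moreover have "list_all2 (\<lambda>a A. (a, A) \<in> lexicon ?G) w (map (movable (Prim 0)) Ys)"
      using Ys(1) w by (auto simp: list_all2_conv_all_nth perm_grammar_def nonempty_words_def)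
    ultimately show ?thesis by blast
  next
    \<comment> \<open>A one-letter word is its only permutation, so plain types suffice.\<close>
    case False
    then obtain a where "u = [a]" using u'(2) by (cases u; cases "tl u") auto
    then have "w = u" using u(2) by simp
    then have "list_all2 (\<lambda>a A. (a, A) \<in> lexicon ?G) w Xs"
      using Xs(1) u'(1) by (auto simp: list_all2_conv_all_nth perm_grammar_def)
    with circ show ?thesis by blast
  qed
  with w show "w \<in> grammar_lang ?G" by (simp add: grammar_lang_def perm_grammar_def)
qed

theorem theorem5:
  fixes \<Sigma> :: "'a set" and L :: "'a list set"
  assumes "finite \<Sigma>"
    and "regular \<Sigma> L"
    and "L \<subseteq> nonempty_words \<Sigma>"
  shows "\<exists>G :: 'a grammar. is_grammar G \<and> alphabet G = \<Sigma> \<and> grammar_lang G = PERM L"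
proof -
  from assms(2) obtain M :: "(nat, 'a) dfa" where M: "is_dfa \<Sigma> M" "L = dfa_lang \<Sigma> M"
    by (auto simp: regular_def)
  have "alphabet (perm_grammar \<Sigma> M) = \<Sigma>" by (simp add: perm_grammar_def)
  then show ?thesis
    using is_grammar_perm_grammar[OF assms(1) M(1)] grammar_lang_perm_grammar[of \<Sigma> M] M assms(3)
    by blast
qed

end
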